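(* There is a set $X \subseteq \omega^{\uparrow\omega}$ with $X \in w^0$ and $X \notin t^0$, i.e. $w^0 \setminus t^0 \neq \emptyset$.
   Context: $\omega^{\uparrow<\omega}$ denotes the set of strictly increasing finite sequences of natural numbers and $\omega^{\uparrow\omega}$ the set of strictly increasing infinite sequences (identified with infinite subsets of $\omega$ via increasing enumeration). A tree is a nonempty subset $T\subseteq\omega^{\uparrow<\omega}$ closed under initial segments; $[T]$ is its set of infinite branches in $\omega^{\uparrow\omega}$. For a family $\mathbb P$ of trees, the associated ideal consists of all $X\subseteq\omega^{\uparrow\omega}$ such that for every $T\in\mathbb P$ there is $T'\in\mathbb P$ with $T'\subseteq T$ and $[T']\cap X=\emptyset$. A willow tree is determined by a sequence $A=\{a_n;n\in\omega\}$ of nonempty finite subsets of $\omega$ with $\max a_n<\min a_{n+1}$ and a function $f:\omega\setminus\bigcup A\to 2$; it is the tree of all finite initial segments of increasing enumerations of infinite sets $x\subseteq\omega$ with $x\setminus\bigcup A=f^{-1}(\{1\})$ and, for each $n$, either $a_n\subseteq x$ or $a_n\cap x=\emptyset$; $w^0$ is the ideal associated with willow trees. A Matet tree is determined by a finite set $s\subseteq\omega$ and a sequence $\{a_n;n\in\omega\}$ of nonempty finite subsets of $\omega$ with $\max s<\min a_0$ and $\max a_n<\min a_{n+1}$; it is the tree of all finite initial segments of increasing enumerations of sets $s\cup\bigcup_{n\in B}a_n$ with $B\subseteq\omega$ infinite; $t^0$ is the ideal associated with Matet trees. *)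

theory Defs
  imports Main "HOL-Library.Infinite_Set" "HOL-Library.FuncSet"
begin

definition incr_fin :: "nat list set" where
  "incr_fin = {\<sigma>. sorted_wrt (<) \<sigma>}"

definition incr_inf :: "(nat \<Rightarrow> nat) set" where
  "incr_inf = {g. strict_mono g}"

definition init_seg :: "(nat \<Rightarrow> nat) \<Rightarrow> nat \<Rightarrow> nat list" where
  "init_seg g n = map g [0..<n]"

definition is_tree :: "nat list set \<Rightarrow> bool" where
  "is_tree T \<longleftrightarrow> T \<noteq> {} \<and> T \<subseteq> incr_fin \<and> (\<forall>\<sigma>\<in>T. \<forall>k. take k \<sigma> \<in> T)"

definition branches :: "nat list set \<Rightarrow> (nat \<Rightarrow> nat) set" where
  "branches T = {g \<in> incr_inf. \<forall>n. init_seg g n \<in> T}"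

definition assoc_ideal :: "nat list set set \<Rightarrow> (nat \<Rightarrow> nat) set set" where
  "assoc_ideal P = {X. X \<subseteq> incr_inf \<and>
     (\<forall>T\<in>P. \<exists>T'\<in>P. T' \<subseteq> T \<and> branches T' \<inter> X = {})}"

text \<open>\<^const>\<open>enumerate\<close> lists an infinite set increasingly, so all sets in \<open>S\<close>
  are meant to be infinite.\<close>

definition tree_of_sets :: "nat set set \<Rightarrow> nat list set" where
  "tree_of_sets S = {init_seg (enumerate x) n | x n. x \<in> S}"

definition block_seq :: "(nat \<Rightarrow> nat set) \<Rightarrow> bool" where
  "block_seq a \<longleftrightarrow> (\<forall>n. finite (a n) \<and> a n \<noteq> {} \<and> Max (a n) < Min (a (Suc n)))"

text \<open>The function \<open>f\<close> is total here, but its values on \<open>\<Union>(range a)\<close> are never used.\<close>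

definition willow_sets :: "(nat \<Rightarrow> nat set) \<Rightarrow> (nat \<Rightarrow> nat) \<Rightarrow> nat set set" where
  "willow_sets a f = {x. infinite x \<and>
     x - \<Union>(range a) = {k \<in> - \<Union>(range a). f k = 1} \<and>
     (\<forall>n. a n \<subseteq> x \<or> a n \<inter> x = {})}"

definition willow_trees :: "nat list set set" where
  "willow_trees = {tree_of_sets (willow_sets a f) | a f.
     block_seq a \<and> f \<in> - \<Union>(range a) \<rightarrow> {0, 1}}"

definition matet_sets :: "nat set \<Rightarrow> (nat \<Rightarrow> nat set) \<Rightarrow> nat set set" where
  "matet_sets s a = {s \<union> (\<Union>n\<in>B. a n) | B. infinite B}"

text \<open>The stem \<open>s\<close> may be empty, in which case the condition \<open>Max s < Min (a 0)\<close> is void.\<close>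

definition matet_trees :: "nat list set set" where
  "matet_trees = {tree_of_sets (matet_sets s a) | s a.
     finite s \<and> block_seq a \<and> (s \<noteq> {} \<longrightarrow> Max s < Min (a 0))}"

definition w0 :: "(nat \<Rightarrow> nat) set set" where
  "w0 = assoc_ideal willow_trees"

definition t0 :: "(nat \<Rightarrow> nat) set set" where
  "t0 = assoc_ideal matet_trees"

lemma is_tree_tree_of_sets:
  assumes "S \<noteq> {}" and "\<And>x. x \<in> S \<Longrightarrow> infinite x"
  shows "is_tree (tree_of_sets S)"
proof -
  have "sorted_wrt (<) (init_seg (enumerate x) n)" if "x \<in> S" for x n
    using enumerate_mono[OF _ assms(2)[OF that]]
    by (auto simp: init_seg_def sorted_wrt_iff_nth_less)
  moreover have "take k (init_seg g n) = init_seg g (min k n)" for k n g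
    by (simp add: init_seg_def take_map min_def)
  moreover have "init_seg (enumerate x) n \<in> tree_of_sets S" if "x \<in> S" for x n
    using that by (auto simp: tree_of_sets_def)
  ultimately show ?thesis
    using assms(1) by (auto simp: is_tree_def tree_of_sets_def incr_fin_def)
qed

lemma block_seq_less:
  assumes "block_seq a" "m < n" "i \<in> a m" "j \<in> a n"
  shows "i < j"
  using assms(2,4)
proof (induction n arbitrary: j)
  case (Suc n)
  have fin: "finite (a k)" "a k \<noteq> {}" "Max (a k) < Min (a (Suc k))" for k
    using assms(1) by (auto simp: block_seq_def)
  have "i \<le> Max (a n)"
  proof (cases "m = n")
    case True
    then show ?thesis using assms(3) fin by simp
  next
    case False
    then show ?thesis
      using Suc.IH[OF _ Max_in[OF fin(1,2)]] Suc.prems(1) by simp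
  qed
  moreover have "Min (a (Suc n)) \<le> j"
    using fin Suc.prems(2) by simp
  ultimately show ?case using fin(3)[of n] by linarith
qed simp

lemma infinite_block_union:
  assumes "block_seq a" "infinite B"
  shows "infinite (\<Union>n\<in>B. a n)"
proof -
  have M: "Min (a n) \<in> a n" for n
    using assms(1) by (auto simp: block_seq_def)
  have "inj_on (\<lambda>n. Min (a n)) B"
  proof (rule inj_onI, rule ccontr)
    fix m n
    assume "Min (a m) = Min (a n)" "m \<noteq> n"
    then show False
      using block_seq_less[OF assms(1) _ M M, of m n] block_seq_less[OF assms(1) _ M M, of n m]
      by (cases "m < n") auto
  qed
  then have "infinite ((\<lambda>n. Min (a n)) ` B)"
    using assms(2) finite_imageD by blast
  moreover have "(\<lambda>n. Min (a n)) ` B \<subseteq> (\<Union>n\<in>B. a n)"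
    using M by blast
  ultimately show ?thesis using finite_subset by blast
qed

lemma willow_trees_are_trees: "T \<in> willow_trees \<Longrightarrow> is_tree T"
proof -
  assume "T \<in> willow_trees"
  then obtain a f where T: "T = tree_of_sets (willow_sets a f)" and a: "block_seq a"
    by (auto simp: willow_trees_def)
  have "\<Union>(range a) \<union> {k \<in> - \<Union>(range a). f k = 1} \<in> willow_sets a f"
    using infinite_block_union[OF a infinite_UNIV_nat] by (auto simp: willow_sets_def)
  then show ?thesis
    unfolding T by (intro is_tree_tree_of_sets) (auto simp: willow_sets_def)
qed

lemma matet_trees_are_trees: "T \<in> matet_trees \<Longrightarrow> is_tree T"
proof -
  assume "T \<in> matet_trees"
  then obtain s a where T: "T = tree_of_sets (matet_sets s a)" and a: "block_seq a"
    by (auto simp: matet_trees_def)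
  have "s \<union> \<Union>(range a) \<in> matet_sets s a"
    using infinite_UNIV_nat by (auto simp: matet_sets_def)
  then show ?thesis
    unfolding T using infinite_block_union[OF a]
    by (intro is_tree_tree_of_sets) (auto simp: matet_sets_def)
qed

end

theory Submission
  imports Defs "HOL-Library.Countable"
begin

text \<open>Every Matet tree contains continuum many branches whose ranges are pairwise almost disjoint
  (the blocks are chosen along an almost disjoint family), whereas all branches of a willow tree
  contain the set \<open>f\<^sup>-\<^sup>1({1})\<close>. So a willow tree with \<open>f\<^sup>-\<^sup>1({1})\<close> infinite contains at most one of
  these branches. As every willow tree contains continuum many disjoint willow trees of this kind, a
  recursion of length continuum can pick a branch of the chosen kind from each Matet tree and a
  willow tree below each willow tree so that none of the picked branches passes through any of the
  picked willow trees.\<close>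

section \<open>Almost disjoint families\<close>

text \<open>Each set \<open>z\<close> is sent to the branch of its finite truncations in a binary
  tree; two different branches share no node beyond the level where they split.\<close>

lemma ex_almost_disjoint_family:
  obtains E :: "'a::countable set \<Rightarrow> nat set"
  where "\<And>z. infinite (E z)" "\<And>z z'. z \<noteq> z' \<Longrightarrow> finite (E z \<inter> E z')"
proof -
  \<comment> \<open>Recording \<open>n\<close> beside the truncation makes \<open>c z\<close>
    injective even where the truncations stop changing, and forces a common code to come from the
    same level on both sides.\<close>
  define c where "c z n = prod_encode (n, set_encode (to_nat ` z \<inter> {..<n}))" for z :: "'a set" and n
  have "inj (c z)" for z
    by (auto simp: c_def inj_def)
  then have inf: "infinite (range (c z))" for z
    by (simp add: finite_image_iff)
  have fin: "finite (range (c z) \<inter> range (c z'))" if ne: "z \<noteq> z'" for z z'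
  proof -
    from ne have "to_nat ` z \<noteq> to_nat ` z'"
      by (simp add: inj_image_eq_iff)
    then obtain k where k: "(k \<in> to_nat ` z) \<noteq> (k \<in> to_nat ` z')"
      by blast
    have "n \<le> k" if "c z n = c z' n" for n
    proof (rule ccontr)
      assume "\<not> n \<le> k"
      moreover have "to_nat ` z \<inter> {..<n} = to_nat ` z' \<inter> {..<n}"
        using that by (simp add: c_def set_encode_eq)
      ultimately show False
        using k by auto
    qed
    then have "range (c z) \<inter> range (c z') \<subseteq> c z ` {..k}"
      by (auto simp: c_def)
    then show ?thesis
      using finite_subset by blast
  qed
  show ?thesis
    using that[of "\<lambda>z. range (c z)"] inf fin by blast
qed

section \<open>Transfinite recursion avoiding all conflicts\<close>

text \<open>The index type is well-ordered in the order type of its cardinality, so each stage has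
  fewer predecessors than candidates. By \<open>p\<close> each set excludes at most one candidate
  for the new point, and by \<open>Q\<close> each point excludes at most one candidate for the new
  set.\<close>

lemma ex_transversal_avoiding:
  includes cardinal_syntax
  fixes p :: "'i \<Rightarrow> 'i \<Rightarrow> 'b" and Q :: "'i \<Rightarrow> 'i \<Rightarrow> 'b set"
  assumes inf: "infinite (UNIV :: 'i set)"
    and p: "\<And>i j u u' v. p i u \<in> Q j v \<Longrightarrow> p i u' \<in> Q j v \<Longrightarrow> u = u'"
    and Q: "\<And>i v v'. v \<noteq> v' \<Longrightarrow> Q i v \<inter> Q i v' = {}"
  shows "\<exists>u v. \<forall>i j. p i (u i) \<notin> Q j (v j)"
proof -
  let ?r = "|UNIV :: 'i set|"
  let ?R = "?r - Id"
  have wo: "well_order_on UNIV ?r"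
    by (rule card_of_well_order_on)
  then have wf: "wf ?R"
    by (simp add: well_order_on_def)
  have small: "|{j. (j, i) \<in> ?R}| <o |UNIV :: 'i set|" for i
  proof -
    have "{j. (j, i) \<in> ?R} = underS ?r i"
      by (auto simp: underS_def)
    then show ?thesis
      using card_of_underS[OF card_of_Card_order, of i UNIV] by (simp add: Field_card_of)
  qed
  \<comment> \<open>The extra index \<open>k\<close> leaves room for the conflict within a single
    stage, between its own new point and its own new set.\<close>
  have avoid: "\<exists>w. \<not> B k w \<and> (\<forall>j. (j, i) \<in> ?R \<longrightarrow> \<not> B j w)"
    if "\<And>j w w'. B j w \<Longrightarrow> B j w' \<Longrightarrow> w = w'" for B :: "'i \<Rightarrow> 'i \<Rightarrow> bool" and i k
  proof -
    let ?J = "{k} \<union> {j. (j, i) \<in> ?R}"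
    have "|?J| <o |UNIV :: 'i set|"
      by (intro card_of_Un_ordLess_infinite inf small finite_ordLess_infinite)
        (simp_all add: inf Field_card_of card_of_well_order_on)
    \<comment> \<open>\<open>THE\<close> names the only value that \<open>j\<close> can exclude;
      where \<open>B j\<close> holds of nothing, its arbitrary value costs just one more
      exclusion.\<close>
    then have "|(\<lambda>j. THE w. B j w) ` ?J| <o |UNIV :: 'i set|"
      using card_of_image ordLeq_ordLess_trans by blast
    then have "(\<lambda>j. THE w. B j w) ` ?J \<noteq> UNIV"
      using ordLess_irreflexive by force
    then obtain w where w: "w \<notin> (\<lambda>j. THE w. B j w) ` ?J"
      by blast
    have "\<not> B j w" if "j \<in> ?J" for j
    proof
      assume "B j w"
      then have "(THE w. B j w) = w"
        using \<open>\<And>j w w'. B j w \<Longrightarrow> B j w' \<Longrightarrow> w = w'\<close> by blast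
      then show False
        using w that by blast
    qed
    then show ?thesis
      by blast
  qed
  \<comment> \<open>A stage settles its conflicts with all earlier stages in both directions: new
    point against old sets and old points against new set.\<close>
  define P where "P f i uv \<longleftrightarrow> p i (fst uv) \<notin> Q i (snd uv) \<and>
    (\<forall>j. (j, i) \<in> ?R \<longrightarrow> p i (fst uv) \<notin> Q j (snd (f j)) \<and> p j (fst (f j)) \<notin> Q i (snd uv))"
    for f :: "'i \<Rightarrow> 'i \<times> 'i" and i uv
  have "\<exists>f. \<forall>i. P f i (f i)"
  proof (rule dependent_wf_choice[OF wf])
    show "P f i uv = P g i uv" if "\<And>j. (j, i) \<in> ?R \<Longrightarrow> f j = g j" for f g i uv
      using that by (auto simp: P_def)
    show "\<exists>uv. P f i uv" for f i
    proof -
      have "\<exists>w. \<not> p i w \<in> Q i (snd (f i)) \<and> (\<forall>j. (j, i) \<in> ?R \<longrightarrow> \<not> p i w \<in> Q j (snd (f j)))"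
        by (rule avoid) (use p in blast)
      then obtain u where u: "\<And>j. (j, i) \<in> ?R \<Longrightarrow> p i u \<notin> Q j (snd (f j))"
        by blast
      \<comment> \<open>With \<open>u\<close> fixed, \<open>v\<close> has to avoid the earlier
        points and also the new one, which \<open>?q\<close> places at index
        \<open>i\<close>.\<close>
      let ?q = "\<lambda>j. if j = i then p i u else p j (fst (f j))"
      have "\<exists>w. \<not> ?q i \<in> Q i w \<and> (\<forall>j. (j, i) \<in> ?R \<longrightarrow> \<not> ?q j \<in> Q i w)"
        by (rule avoid) (use Q in blast)
      then obtain v where "p i u \<notin> Q i v" "\<And>j. (j, i) \<in> ?R \<Longrightarrow> p j (fst (f j)) \<notin> Q i v"
        by auto
      then have "P f i (u, v)"
        using u by (simp add: P_def)
      then show ?thesis ..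
    qed
  qed
  then obtain f where f: "\<And>i. P f i (f i)"
    by blast
  have "p i (fst (f i)) \<notin> Q j (snd (f j))" for i j
  proof -
    \<comment> \<open>Whichever of the two indices comes later has settled the pair.\<close>
    have "i = j \<or> (i, j) \<in> ?R \<or> (j, i) \<in> ?R"
      using wo by (auto simp: well_order_on_def linear_order_on_def total_on_def)
    then show ?thesis
      using f[of i] f[of j] by (auto simp: P_def)
  qed
  then show ?thesis
    by (intro exI[of _ "\<lambda>i. fst (f i)"] exI[of _ "\<lambda>i. snd (f i)"]) simp
qed

section \<open>Branches of trees generated by sets\<close>

lemma range_enumerate_eq: "infinite x \<Longrightarrow> range (enumerate x) = x" for x :: "nat set"
  using bij_enumerate bij_betw_imp_surj_on by blast

lemma enumerate_in_branches:
  assumes "x \<in> S" "infinite x"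
  shows "enumerate x \<in> branches (tree_of_sets S)"
  using assms by (auto simp: branches_def incr_inf_def tree_of_sets_def strict_mono_enumerate)

text \<open>Since \<open>n \<le> g n\<close> for all \<open>n\<close>, the value \<open>k\<close>
  can occur only at a position up to \<open>k\<close>.\<close>

lemma in_range_strict_mono_iff:
  fixes g :: "nat \<Rightarrow> nat"
  assumes "strict_mono g"
  shows "k \<in> range g \<longleftrightarrow> k \<in> g ` {..k}"
  using strict_mono_imp_increasing[OF assms] by auto

text \<open>A branch need not enumerate a member of \<open>S\<close>, but its first
  \<open>k + 1\<close> terms are those of some member's enumeration, and they already decide whether
  \<open>k\<close> occurs.\<close>

lemma branches_tree_of_sets_approx:
  assumes g: "g \<in> branches (tree_of_sets S)" and S: "\<And>x. x \<in> S \<Longrightarrow> infinite x"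
  obtains x where "x \<in> S" "k \<in> range g \<longleftrightarrow> k \<in> x"
proof -
  from g have "init_seg g (Suc k) \<in> tree_of_sets S"
    by (simp add: branches_def)
  then obtain x n where x: "x \<in> S" and eq: "init_seg g (Suc k) = init_seg (enumerate x) n"
    by (auto simp: tree_of_sets_def)
  from eq have "length (init_seg g (Suc k)) = length (init_seg (enumerate x) n)"
    by simp
  then have "n = Suc k"
    by (simp add: init_seg_def)
  with eq have "set (init_seg g (Suc k)) = set (init_seg (enumerate x) (Suc k))"
    by simp
  then have "g ` {..k} = enumerate x ` {..k}"
    by (simp only: init_seg_def set_map set_upt atLeast0LessThan lessThan_Suc_atMost)
  moreover have "strict_mono g" "strict_mono (enumerate x)"
    using g S[OF x] by (simp_all add: branches_def incr_inf_def strict_mono_enumerate)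
  ultimately have "k \<in> range g \<longleftrightarrow> k \<in> range (enumerate x)"
    using in_range_strict_mono_iff by metis
  with that x S[OF x] show thesis
    by (simp add: range_enumerate_eq)
qed

lemma willow_branch_off_blocks:
  assumes "g \<in> branches (tree_of_sets (willow_sets a f))" and k: "k \<notin> \<Union>(range a)"
  shows "k \<in> range g \<longleftrightarrow> f k = 1"
proof -
  obtain x where x: "x \<in> willow_sets a f" "k \<in> range g \<longleftrightarrow> k \<in> x"
    by (rule branches_tree_of_sets_approx[OF assms(1)]) (auto simp: willow_sets_def)
  then have "k \<in> x - \<Union>(range a) \<longleftrightarrow> k \<in> {k \<in> - \<Union>(range a). f k = 1}"
    by (simp add: willow_sets_def)
  with k x(2) show ?thesis
    by blast
qed

lemma tree_of_sets_mono: "S \<subseteq> S' \<Longrightarrow> tree_of_sets S \<subseteq> tree_of_sets S'"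
  by (auto simp: tree_of_sets_def)

section \<open>Willow subtrees obtained by freezing the odd blocks\<close>

lemma block_seq_unique:
  assumes "block_seq a" "k \<in> a m" "k \<in> a n"
  shows "m = n"
  using block_seq_less[OF assms(1) _ assms(2,3)] block_seq_less[OF assms(1) _ assms(3,2)]
  by (metis less_irrefl linorder_neqE_nat)

lemma block_seq_subseq:
  assumes "block_seq a" "strict_mono h"
  shows "block_seq (a \<circ> h)"
proof -
  have *: "finite (a n)" "a n \<noteq> {}" for n
    using assms(1) by (auto simp: block_seq_def)
  have "Max (a (h n)) < Min (a (h (Suc n)))" for n
    using block_seq_less[OF assms(1) _ Max_in[OF *] Min_in[OF *]] assms(2)
    by (simp add: strict_mono_Suc_iff)
  with * show ?thesis
    by (simp add: block_seq_def)
qed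

text \<open>Codes \<open>E\<close> into the part that all branches share: the choice at the odd
  blocks is frozen according to \<open>E\<close>, while the even blocks stay free, so that a willow
  tree remains.\<close>

definition fix_odd :: "(nat \<Rightarrow> nat set) \<Rightarrow> (nat \<Rightarrow> nat) \<Rightarrow> nat set \<Rightarrow> nat \<Rightarrow> nat" where
  "fix_odd a f E k = (if \<exists>n. k \<in> a (2 * n + 1)
     then if \<exists>n\<in>E. k \<in> a (2 * n + 1) then 1 else 0 else f k)"

definition even_blocks :: "(nat \<Rightarrow> nat set) \<Rightarrow> nat \<Rightarrow> nat set" where
  "even_blocks a = a \<circ> (\<lambda>n. 2 * n)"

definition thinned_willow :: "(nat \<Rightarrow> nat set) \<Rightarrow> (nat \<Rightarrow> nat) \<Rightarrow> nat set \<Rightarrow> nat list set" where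
  "thinned_willow a f E = tree_of_sets (willow_sets (even_blocks a) (fix_odd a f E))"

lemma fix_odd_on_block:
  assumes "block_seq a" "k \<in> a (2 * n + 1)"
  shows "fix_odd a f E k = (if n \<in> E then 1 else 0)"
proof -
  have "m = n" if "k \<in> a (2 * m + 1)" for m
    using block_seq_unique[OF assms(1) that assms(2)] by simp
  then have "(\<exists>n. k \<in> a (2 * n + 1))" "(\<exists>n\<in>E. k \<in> a (2 * n + 1)) \<longleftrightarrow> n \<in> E"
    using assms(2) by blast+
  then show ?thesis
    by (simp add: fix_odd_def)
qed

lemma odd_block_not_even:
  assumes "block_seq a" "k \<in> a (2 * n + 1)"
  shows "k \<notin> \<Union>(range (even_blocks a))"
proof
  assume "k \<in> \<Union>(range (even_blocks a))"
  then obtain m where "k \<in> a (2 * m)"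
    by (auto simp: even_blocks_def)
  then have "2 * m = 2 * n + 1"
    using block_seq_unique[OF assms(1) _ assms(2)] by blast
  then show False
    by presburger
qed

lemma thinned_willow_in_willow_trees:
  assumes a: "block_seq a" and f: "f \<in> - \<Union>(range a) \<rightarrow> {0, 1}"
  shows "thinned_willow a f E \<in> willow_trees"
proof -
  have "fix_odd a f E \<in> - \<Union>(range (even_blocks a)) \<rightarrow> {0, 1}"
  proof
    fix k
    assume k: "k \<in> - \<Union>(range (even_blocks a))"
    show "fix_odd a f E k \<in> {0, 1}"
    proof (cases "\<exists>n. k \<in> a (2 * n + 1)")
      \<comment> \<open>Here \<open>k\<close> lies in no block of \<open>a\<close> at all, so
        \<open>f\<close> takes a value in \<open>{0, 1}\<close> there.\<close>
      case False
      have "k \<notin> a n" for n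
        using k False by (cases "even n") (auto simp: even_blocks_def elim!: evenE oddE)
      then show ?thesis
        using f False by (auto simp: fix_odd_def)
    qed (simp add: fix_odd_def)
  qed
  moreover have "block_seq (even_blocks a)"
    unfolding even_blocks_def by (rule block_seq_subseq[OF a]) (simp add: strict_mono_def)
  ultimately show ?thesis
    unfolding willow_trees_def thinned_willow_def by blast
qed

lemma thinned_willow_subset:
  assumes a: "block_seq a"
  shows "thinned_willow a f E \<subseteq> tree_of_sets (willow_sets a f)"
  unfolding thinned_willow_def
proof (intro tree_of_sets_mono subsetI)
  fix x
  assume x: "x \<in> willow_sets (even_blocks a) (fix_odd a f E)"
  then have off: "k \<in> x \<longleftrightarrow> fix_odd a f E k = 1" if "k \<notin> \<Union>(range (even_blocks a))" for k
    using that unfolding willow_sets_def by blast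
  have odd: "k \<in> x \<longleftrightarrow> n \<in> E" if "k \<in> a (2 * n + 1)" for k n
    using off[OF odd_block_not_even[OF a that]] fix_odd_on_block[OF a that] by simp
  have "k \<in> x \<longleftrightarrow> f k = 1" if "k \<notin> \<Union>(range a)" for k
  proof -
    have "k \<notin> \<Union>(range (even_blocks a))" "fix_odd a f E k = f k"
      using that by (auto simp: even_blocks_def fix_odd_def)
    then show ?thesis
      using off by simp
  qed
  then have "x - \<Union>(range a) = {k \<in> - \<Union>(range a). f k = 1}"
    by blast
  moreover have "a n \<subseteq> x \<or> a n \<inter> x = {}" for n
  proof (cases "even n")
    case True
    then obtain m where "n = 2 * m" by (elim evenE)
    then have "a n = even_blocks a m" by (simp add: even_blocks_def)
    then show ?thesis
      using x by (simp add: willow_sets_def)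
  next
    case False
    then obtain m where "n = 2 * m + 1" by (elim oddE)
    then show ?thesis
      using odd by blast
  qed
  ultimately show "x \<in> willow_sets a f"
    using x by (simp add: willow_sets_def)
qed

text \<open>The odd blocks lie off the remaining blocks, where all branches agree. Hence any single
  branch determines \<open>E\<close>.\<close>

lemma thinned_willow_branch_odd:
  assumes "block_seq a" "g \<in> branches (thinned_willow a f E)" "k \<in> a (2 * n + 1)"
  shows "k \<in> range g \<longleftrightarrow> n \<in> E"
  using willow_branch_off_blocks[OF _ odd_block_not_even[OF assms(1,3)]] assms(2)
    fix_odd_on_block[OF assms(1,3)]
  by (simp add: thinned_willow_def)

lemma thinned_willow_disjoint:
  assumes a: "block_seq a" and "E \<noteq> E'"
  shows "branches (thinned_willow a f E) \<inter> branches (thinned_willow a f E') = {}"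
proof -
  obtain n where n: "(n \<in> E) \<noteq> (n \<in> E')"
    using assms(2) by blast
  obtain k where "k \<in> a (2 * n + 1)"
    using a unfolding block_seq_def by blast
  then show ?thesis
    using thinned_willow_branch_odd[OF a] n by blast
qed

text \<open>Both ranges contain all the odd blocks selected by \<open>E\<close>.\<close>

lemma thinned_willow_branches_inter_infinite:
  assumes a: "block_seq a" and E: "infinite E"
    and "g \<in> branches (thinned_willow a f E)" "g' \<in> branches (thinned_willow a f E)"
  shows "infinite (range g \<inter> range g')"
proof -
  have "block_seq (a \<circ> (\<lambda>n. 2 * n + 1))"
    by (rule block_seq_subseq[OF a]) (simp add: strict_mono_def)
  from infinite_block_union[OF this E] have "infinite (\<Union>n\<in>E. a (2 * n + 1))"
    by simp
  moreover have "(\<Union>n\<in>E. a (2 * n + 1)) \<subseteq> range g \<inter> range g'"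
    using thinned_willow_branch_odd[OF a] assms(3,4) by blast
  ultimately show ?thesis
    using finite_subset by blast
qed

section \<open>Choosing branches of Matet trees\<close>

text \<open>Blocks are pairwise disjoint, so outside \<open>s\<close> the two sets meet only in
  blocks whose index lies in both \<open>B\<close> and \<open>B'\<close>.\<close>

lemma finite_matet_inter:
  assumes a: "block_seq a" and "finite s" "finite (B \<inter> B')"
  shows "finite ((s \<union> (\<Union>n\<in>B. a n)) \<inter> (s \<union> (\<Union>n\<in>B'. a n)))"
proof (rule finite_subset)
  show "(s \<union> (\<Union>n\<in>B. a n)) \<inter> (s \<union> (\<Union>n\<in>B'. a n)) \<subseteq> s \<union> (\<Union>n\<in>B \<inter> B'. a n)"
    using block_seq_unique[OF a] by blast
  show "finite (s \<union> (\<Union>n\<in>B \<inter> B'. a n))"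
    using assms by (auto simp: block_seq_def)
qed

text \<open>Supplies dummy parameters for indices that are not trees of the required kind, and an
  example of a Matet tree.\<close>

lemma block_seq_singletons: "block_seq (\<lambda>n. {n})"
  by (simp add: block_seq_def)

theorem theorem2p3:
  "\<exists>X. X \<subseteq> incr_inf \<and> X \<in> w0 \<and> X \<notin> t0"
proof -
  \<comment> \<open>One type indexes the trees, the candidate branches and the candidate subtrees,
    as the recursion requires.\<close>
  obtain E :: "nat list set \<Rightarrow> nat set" where E: "\<And>z. infinite (E z)"
    and ad: "\<And>z z'. z \<noteq> z' \<Longrightarrow> finite (E z \<inter> E z')"
    using ex_almost_disjoint_family by metis
  have E_inj: "E z \<noteq> E z'" if "z \<noteq> z'" for z z'
    using ad[OF that] E[of z] by auto
  \<comment> \<open>The recursion runs over the whole type, so a set that is not a Matet tree also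
    gets parameters, with singleton blocks available as a dummy choice.\<close>
  have "\<forall>T. \<exists>s a. finite s \<and> block_seq a \<and>
      (T \<in> matet_trees \<longrightarrow> T = tree_of_sets (matet_sets s a))"
    using block_seq_singletons unfolding matet_trees_def by blast
  then obtain s a where fin: "\<And>T. finite (s T)" and a: "\<And>T. block_seq (a T)"
    and matet: "\<And>T. T \<in> matet_trees \<Longrightarrow> T = tree_of_sets (matet_sets (s T) (a T))"
    by metis
  have "\<forall>W. \<exists>b f. block_seq b \<and> (W \<in> willow_trees \<longrightarrow>
      f \<in> - \<Union>(range b) \<rightarrow> {0, 1} \<and> W = tree_of_sets (willow_sets b f))"
    using block_seq_singletons unfolding willow_trees_def by blast
  then obtain b f where b: "\<And>W. block_seq (b W)"
    and willow: "\<And>W. W \<in> willow_trees \<Longrightarrow> f W \<in> - \<Union>(range (b W)) \<rightarrow> {0, 1}"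
      "\<And>W. W \<in> willow_trees \<Longrightarrow> W = tree_of_sets (willow_sets (b W) (f W))"
    by metis
  define x where "x T u = s T \<union> (\<Union>n\<in>E u. a T n)" for T u
  define p where "p T u = enumerate (x T u)" for T u
  define Q where "Q W v = branches (thinned_willow (b W) (f W) (E v))" for W v
  have x: "infinite (x T u)" for T u
    using infinite_block_union[OF a E] by (simp add: x_def)
  have range_p: "range (p T u) = x T u" for T u
    using x by (simp add: p_def range_enumerate_eq)
  have "infinite (UNIV :: nat list set set)"
    by (simp add: Finite_Set.finite_set infinite_UNIV_listI)
  moreover have "u = u'" if "p T u \<in> Q W v" "p T u' \<in> Q W v" for T W u u' v
  proof (rule ccontr)
    \<comment> \<open>Almost disjoint index sets give almost disjoint ranges, whereas two branches
      of one thinned tree share infinitely many points.\<close>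
    assume "u \<noteq> u'"
    then have "finite (x T u \<inter> x T u')"
      unfolding x_def by (intro finite_matet_inter a fin ad)
    then show False
      using thinned_willow_branches_inter_infinite[OF b E] that range_p unfolding Q_def by metis
  qed
  moreover have "Q W v \<inter> Q W v' = {}" if "v \<noteq> v'" for W v v'
    unfolding Q_def using thinned_willow_disjoint[OF b E_inj[OF that]] .
  ultimately have "\<exists>u v. \<forall>T W. p T (u T) \<notin> Q W (v W)"
    by (rule ex_transversal_avoiding[where p = p and Q = Q])
  then obtain u v where uv: "\<And>T W. p T (u T) \<notin> Q W (v W)"
    by blast
  \<comment> \<open>The points from dummy indices belong to \<open>?X\<close> too; \<open>uv\<close>
    keeps them off the thinned trees as well.\<close>
  let ?X = "range (\<lambda>T. p T (u T))"
  have sub: "?X \<subseteq> incr_inf"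
    using x by (auto simp: incr_inf_def p_def strict_mono_enumerate)
  moreover have "\<exists>W'\<in>willow_trees. W' \<subseteq> W \<and> branches W' \<inter> ?X = {}" if W: "W \<in> willow_trees" for W
  proof (intro bexI conjI)
    let ?W = "thinned_willow (b W) (f W) (E (v W))"
    show "?W \<in> willow_trees"
      using thinned_willow_in_willow_trees[OF b willow(1)[OF W]] .
    show "?W \<subseteq> W"
      using thinned_willow_subset[OF b] willow(2)[OF W] by metis
    show "branches ?W \<inter> ?X = {}"
      using uv unfolding Q_def by blast
  qed
  moreover have "?X \<notin> t0"
  proof
    assume "?X \<in> t0"
    \<comment> \<open>Membership in \<open>t0\<close> yields a Matet tree missing \<open>?X\<close>
      only below a given one, so some Matet tree has to be exhibited; any would serve.\<close>
    moreover have "tree_of_sets (matet_sets {} (\<lambda>n. {n})) \<in> matet_trees"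
      using block_seq_singletons unfolding matet_trees_def by blast
    ultimately obtain T where T: "T \<in> matet_trees" "branches T \<inter> ?X = {}"
      unfolding t0_def assoc_ideal_def by blast
    have "x T (u T) \<in> matet_sets (s T) (a T)"
      unfolding x_def matet_sets_def using E by blast
    then have "p T (u T) \<in> branches T"
      using enumerate_in_branches[OF _ x] matet[OF T(1)] unfolding p_def by metis
    then show False
      using T(2) by blast
  qed
  ultimately show ?thesis
    unfolding w0_def assoc_ideal_def by blast
qed

end
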